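(* Assume $\mathcal Q_\Lambda^{\mathrm{cl}}\neq\{0\}$, gauge compatibility and the kernel-free condition for the clean detector (defined in the context). Assume moreover that there are constants $0\le\varepsilon_G<1$, $\delta_G\ge0$, $\eta_\Lambda^{\sharp,\mathrm{tail}}\ge0$, $\Delta_\Lambda^{\sharp,\mathrm{tail}}\ge0$ such that every intrinsic package $\mathcal D$ satisfies $$\operatorname{dist}_{\mathrm{cl}}(\Theta_\Lambda\mathcal D,\Gamma_\Lambda^{\mathrm{cl}})\ge(1-\varepsilon_G)\operatorname{dist}^{\sharp,\mathrm{tail}}(\mathcal D)-\delta_G,$$ $$\mathcal M_\Lambda^{\mathrm{loc}}(\mathcal D)+\mathsf{Err}_\Lambda^{\mathrm{loc}}(\mathcal D)\ge\mathcal M_\Lambda^{\mathrm{comp}}(\Theta_\Lambda\mathcal D),$$ $$\mathsf{Err}_\Lambda^{\mathrm{loc}}(\mathcal D)\le\eta_\Lambda^{\sharp,\mathrm{tail}}\operatorname{dist}^{\sharp,\mathrm{tail}}(\mathcal D)+\Delta_\Lambda^{\sharp,\mathrm{tail}}.$$ Then every intrinsic package $\mathcal D$ satisfies $$\mathcal M_\Lambda^{\mathrm{loc}}(\mathcal D)\ge\big(\mu_\Lambda^{\mathrm{comp}}(1-\varepsilon_G)-\eta_\Lambda^{\sharp,\mathrm{tail}}\big)\operatorname{dist}^{\sharp,\mathrm{tail}}(\mathcal D)-\mu_\Lambda^{\mathrm{comp}}\delta_G-\Delta_\Lambda^{\sharp,\mathrm{tail}}.$$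
   Context: Clean setting. Let $\Lambda=\{k_0,\dots,k_0+L\}$ be a finite set of consecutive integers, $\Lambda_{\mathrm{adj}}=\{k\in\Lambda: k+1\in\Lambda\}$. For $k\in\Lambda$ let $\mathcal D_k^{\mathrm{cl}}$ be a finite-dimensional real normed space with norm $\|\cdot\|_{\mathrm{cl},k}$; $\mathcal D_\Lambda^{\mathrm{cl}}=\prod_{k}\mathcal D_k^{\mathrm{cl}}$ carries a fixed norm $\|\cdot\|_{\mathrm{cl}}$, and $\mathcal K_\Lambda^{\mathrm{cl}}\subset\mathcal D_\Lambda^{\mathrm{cl}}$ is a linear subspace. $G_\Lambda^{\mathrm{cl}}:\mathcal C_\Lambda^{\mathrm{cl}}\to\mathcal D_\Lambda^{\mathrm{cl}}$ is linear from a finite-dimensional real normed space, $\Gamma_\Lambda^{\mathrm{cl}}=\mathcal K_\Lambda^{\mathrm{cl}}\cap\operatorname{Im}G_\Lambda^{\mathrm{cl}}$, $\operatorname{dist}_{\mathrm{cl}}(d,\Gamma_\Lambda^{\mathrm{cl}})=\inf_{\gamma\in\Gamma_\Lambda^{\mathrm{cl}}}\|d-\gamma\|_{\mathrm{cl}}$, which is the quotient norm on $\mathcal Q_\Lambda^{\mathrm{cl}}=\mathcal K_\Lambda^{\mathrm{cl}}/\Gamma_\Lambda^{\mathrm{cl}}$; $S_\Lambda^{\mathrm{cl}}$ is its unit sphere. $O_\Lambda^{\mathrm{cl}}$ is a linear map from $\mathcal K_\Lambda^{\mathrm{cl}}$ to a finite product of finite-dimensional normed spaces (with a fixed norm). For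 fixed linear $R_k^{\mathrm{cl}}:\mathcal D_k^{\mathrm{cl}}\to\mathcal D_{k+1}^{\mathrm{cl}}$, $\operatorname{Rep}_\Lambda^{\mathrm{cl}}(d)=\big(\sum_{k\in\Lambda_{\mathrm{adj}}}\|d_{k+1}-R_k^{\mathrm{cl}}d_k\|_{\mathrm{cl},k+1}^2\big)^{1/2}$. $\operatorname{Tax}_\Lambda^{\mathrm{cl}}:\mathcal K_\Lambda^{\mathrm{cl}}\to[0,\infty)$ is continuous with $\operatorname{Tax}_\Lambda^{\mathrm{cl}}(\lambda d)=|\lambda|\operatorname{Tax}_\Lambda^{\mathrm{cl}}(d)$. For fixed $C_R,C_T>0$, $\mathcal M_\Lambda^{\mathrm{comp}}(d)=\|O_\Lambda^{\mathrm{cl}}d\|+C_R\operatorname{Rep}_\Lambda^{\mathrm{cl}}(d)+C_T\operatorname{Tax}_\Lambda^{\mathrm{cl}}(d)$. Gauge compatibility: $O_\Lambda^{\mathrm{cl}}$, $\operatorname{Rep}_\Lambda^{\mathrm{cl}}$, $\operatorname{Tax}_\Lambda^{\mathrm{cl}}$ are each unchanged when $d\in\mathcal K_\Lambda^{\mathrm{cl}}$ is replaced by $d+\gamma$, $\gamma\in\Gamma_\Lambda^{\mathrm{cl}}$. Kernel-free condition: if $d\in\mathcal K_\Lambda^{\mathrm{cl}}$ and $O_\Lambda^{\mathrm{cl}}d=0$, $\operatorname{Rep}_\Lambda^{\mathrm{cl}}(d)=0$, $\operatorname{Tax}_\Lambda^{\mathrm{cl}}(d)=0$, then $d\in\Gamma_\Lambda^{\mathrm{cl}}$.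 Under gauge compatibility $\mathcal M_\Lambda^{\mathrm{comp}}$ descends to $\overline{\mathcal M}_\Lambda^{\mathrm{comp}}$ on $\mathcal Q_\Lambda^{\mathrm{cl}}$, and $\mu_\Lambda^{\mathrm{comp}}=\inf_{q\in S_\Lambda^{\mathrm{cl}}}\overline{\mathcal M}_\Lambda^{\mathrm{comp}}(q)$. Intrinsic packages. For $k\in\Lambda$, $j=1,\dots,7$, let $X_k^{(j)}$ be normed spaces; an intrinsic package is $\mathcal D=(x_k^{(j)})_{k,j}$, $x_k^{(j)}\in X_k^{(j)}$, with norm $\|\mathcal D\|_{\mathrm{loc,int}}^2=\sum_{k}\sum_{j}a_j\|x_k^{(j)}\|^2$, $a_j>0$ fixed; $\mathfrak I_\Lambda^{\mathrm{loc}}$ is the space of intrinsic packages and $\Gamma_\Lambda^{\mathrm{int}}\subset\mathfrak I_\Lambda^{\mathrm{loc}}$ a linear subspace. $\Theta_\Lambda:\mathfrak I_\Lambda^{\mathrm{loc}}\to\mathcal K_\Lambda^{\mathrm{cl}}$ is a map, $\mathcal M_\Lambda^{\mathrm{loc}},\mathsf{Err}_\Lambda^{\mathrm{loc}}:\mathfrak I_\Lambda^{\mathrm{loc}}\to[0,\infty)$ are functions. Enhanced-tail distance. Let $B_r\subset\mathbb R^3$ be the ball of radius $r$ about $0$, $I=(-1,0)$, $Y_{\mathrm{prs}}=L^{3/2}(I;L^{3/2}(B_{1/2}))$, and $\mathsf R_i$ the Riesz transforms on $\mathbb R^3$ (tensors on $B_1$ are extended by zero, repeated indices summed, results restricted to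 $B_{1/2}$). Each package $\mathcal D$ carries a clean source tensor $F^{\mathrm{cl}}_{ij}(\mathcal D)=U_iU_j+R_{ij}\in L^{3/2}(I;L^{3/2}(B_1))$ built from its clean velocity and covariance coordinates $U,R$, and a harmonic pressure component $p_{\mathrm{harm}}(\mathcal D)$ in a normed space $Y_{\mathrm{harm}}$. $P_{\mathrm{prs},N}^{\mathrm{cl}}$ is a bounded linear projection on $Y_{\mathrm{prs}}$, $\Pi_{\mathrm{harm},M}$ a bounded projection of $Y_{\mathrm{harm}}$ onto a finite-dimensional subspace, $J_{\mathrm{harm}}:Y_{\mathrm{harm}}\to Y_{\mathrm{prs}}$ bounded linear. For $\zeta\in\Gamma_\Lambda^{\mathrm{int}}$, $\mathcal T_{\mathrm{proj}}(\mathcal D;\zeta)=(1+\|P_{\mathrm{prs},N}^{\mathrm{cl}}\|)\|\mathsf R_i\mathsf R_jF_{ij}^{\mathrm{cl}}(\mathcal D-\zeta)\|_{Y_{\mathrm{prs}}}$, $\mathcal T_{\mathrm{harm}}(\mathcal D;\zeta)=\|J_{\mathrm{harm}}\|\,\|(I-\Pi_{\mathrm{harm},M})p_{\mathrm{harm}}(\mathcal D-\zeta)\|_{Y_{\mathrm{harm}}}$. For fixed $\alpha_{\mathrm{proj}},\alpha_{\mathrm{harm}}>0$, $$\operatorname{dist}^{\sharp,\mathrm{tail}}(\mathcal D)=\inf_{\zeta\in\Gamma_\Lambda^{\mathrm{int}}}\big(\|\mathcal D-\zeta\|_{\mathrm{loc,int}}+\alpha_{\mathrm{proj}}\mathcal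 T_{\mathrm{proj}}(\mathcal D;\zeta)+\alpha_{\mathrm{harm}}\mathcal T_{\mathrm{harm}}(\mathcal D;\zeta)\big).$$ *)

theory Defs
  imports "HOL-Analysis.Analysis" "HOL-Library.Function_Algebras"
begin

section \<open>Finite products of normed spaces\<close>

text \<open>Products over a varying index set are sets of functions, so functions into a real vector
  space are made a real vector space with pointwise operations.\<close>

instantiation "fun" :: (type, real_vector) real_vector
begin

definition scaleR_fun :: "real \<Rightarrow> ('a \<Rightarrow> 'b) \<Rightarrow> 'a \<Rightarrow> 'b" where
  "scaleR_fun c f = (\<lambda>x. c *\<^sub>R f x)"

instance
  by standard (simp_all add: scaleR_fun_def fun_eq_iff scaleR_add_right scaleR_add_left)

end

text \<open>A family of pairwise unrelated normed spaces is represented by linear subspaces of one ambient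
  real vector space, each with its own norm. This is no restriction: every family of real vector
  spaces embeds into its direct sum. Values of \<open>vnorm\<close> outside \<open>vecs\<close> are irrelevant.\<close>

definition norm_on :: "'a::real_vector set \<Rightarrow> ('a \<Rightarrow> real) \<Rightarrow> bool" where
  "norm_on V n \<longleftrightarrow>
     (\<forall>x\<in>V. 0 \<le> n x) \<and> (\<forall>x\<in>V. n x = 0 \<longleftrightarrow> x = 0) \<and>
     (\<forall>x\<in>V. \<forall>y\<in>V. n (x + y) \<le> n x + n y) \<and> (\<forall>c. \<forall>x\<in>V. n (c *\<^sub>R x) = \<bar>c\<bar> * n x)"

record 'a nspace =
  vecs :: "'a set"
  vnorm :: "'a \<Rightarrow> real"

definition normed_space :: "'a::real_vector nspace \<Rightarrow> bool" where
  "normed_space V \<longleftrightarrow> subspace (vecs V) \<and> norm_on (vecs V) (vnorm V)"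

definition finite_dim :: "'a::real_vector set \<Rightarrow> bool" where
  "finite_dim V \<longleftrightarrow> (\<exists>B. finite B \<and> V = span B)"

definition prod_space :: "'i set \<Rightarrow> ('i \<Rightarrow> 'a::real_vector nspace) \<Rightarrow> ('i \<Rightarrow> 'a) set" where
  "prod_space I E = {x. (\<forall>i\<in>I. x i \<in> vecs (E i)) \<and> (\<forall>i. i \<notin> I \<longrightarrow> x i = 0)}"

definition linear_on :: "'a::real_vector set \<Rightarrow> ('a \<Rightarrow> 'b::real_vector) \<Rightarrow> bool" where
  "linear_on V f \<longleftrightarrow>
     (\<forall>x\<in>V. \<forall>y\<in>V. f (x + y) = f x + f y) \<and> (\<forall>c. \<forall>x\<in>V. f (c *\<^sub>R x) = c *\<^sub>R f x)"


section \<open>The clean detector\<close>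

text \<open>\<open>c_first\<close> is \<open>k\<^sub>0\<close> and \<open>c_len\<close> is \<open>L\<close>; the codomain of \<open>c_obs\<close> is the product of the spaces
  \<open>c_obs_sp C i\<close> over \<open>i < c_obs_num C\<close>, with norm \<open>c_obs_norm\<close>.\<close>

record ('d, 'c, 'o) clean =
  c_first :: int
  c_len :: nat
  c_sp :: "int \<Rightarrow> 'd nspace"
  c_norm :: "(int \<Rightarrow> 'd) \<Rightarrow> real"
  c_K :: "(int \<Rightarrow> 'd) set"
  c_G :: "'c \<Rightarrow> int \<Rightarrow> 'd"
  c_obs_num :: nat
  c_obs_sp :: "nat \<Rightarrow> 'o nspace"
  c_obs_norm :: "(nat \<Rightarrow> 'o) \<Rightarrow> real"
  c_obs :: "(int \<Rightarrow> 'd) \<Rightarrow> nat \<Rightarrow> 'o"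
  c_R :: "int \<Rightarrow> 'd \<Rightarrow> 'd"
  c_Tax :: "(int \<Rightarrow> 'd) \<Rightarrow> real"
  c_CR :: real
  c_CT :: real

definition Lam :: "('d, 'c, 'o) clean \<Rightarrow> int set" where
  "Lam C = {c_first C .. c_first C + int (c_len C)}"

definition Lam_adj :: "('d, 'c, 'o) clean \<Rightarrow> int set" where
  "Lam_adj C = {k \<in> Lam C. k + 1 \<in> Lam C}"

definition D_cl :: "('d::real_vector, 'c, 'o) clean \<Rightarrow> (int \<Rightarrow> 'd) set" where
  "D_cl C = prod_space (Lam C) (c_sp C)"

definition obs_space :: "('d, 'c, 'o::real_vector) clean \<Rightarrow> (nat \<Rightarrow> 'o) set" where
  "obs_space C = prod_space {..<c_obs_num C} (c_obs_sp C)"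

definition clean_setting ::
  "('d::real_vector, 'c::real_normed_vector, 'o::real_vector) clean \<Rightarrow> bool" where
  "clean_setting C \<longleftrightarrow>
     (\<forall>k\<in>Lam C. normed_space (c_sp C k) \<and> finite_dim (vecs (c_sp C k))) \<and>
     norm_on (D_cl C) (c_norm C) \<and>
     subspace (c_K C) \<and> c_K C \<subseteq> D_cl C \<and>
     finite_dim (UNIV :: 'c set) \<and> linear (c_G C) \<and> range (c_G C) \<subseteq> D_cl C \<and>
     (\<forall>i<c_obs_num C. normed_space (c_obs_sp C i) \<and> finite_dim (vecs (c_obs_sp C i))) \<and>
     norm_on (obs_space C) (c_obs_norm C) \<and>
     linear_on (c_K C) (c_obs C) \<and> c_obs C ` c_K C \<subseteq> obs_space C \<and>
     (\<forall>k\<in>Lam_adj C. linear_on (vecs (c_sp C k)) (c_R C k) \<and>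
        c_R C k ` vecs (c_sp C k) \<subseteq> vecs (c_sp C (k + 1))) \<and>
     (\<forall>d\<in>c_K C. 0 \<le> c_Tax C d) \<and>
     (\<forall>d\<in>c_K C. \<forall>e>0. \<exists>s>0. \<forall>d'\<in>c_K C.
        c_norm C (d' - d) < s \<longrightarrow> \<bar>c_Tax C d' - c_Tax C d\<bar> < e) \<and>
     (\<forall>t. \<forall>d\<in>c_K C. c_Tax C (t *\<^sub>R d) = \<bar>t\<bar> * c_Tax C d) \<and>
     c_CR C > 0 \<and> c_CT C > 0"

definition Gam :: "('d, 'c, 'o) clean \<Rightarrow> (int \<Rightarrow> 'd) set" where
  "Gam C = c_K C \<inter> range (c_G C)"

definition dist_cl :: "('d::real_vector, 'c, 'o) clean \<Rightarrow> (int \<Rightarrow> 'd) \<Rightarrow> real" where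
  "dist_cl C d = (INF \<gamma>\<in>Gam C. c_norm C (d - \<gamma>))"

definition Rep :: "('d::real_vector, 'c, 'o) clean \<Rightarrow> (int \<Rightarrow> 'd) \<Rightarrow> real" where
  "Rep C d = sqrt (\<Sum>k\<in>Lam_adj C. (vnorm (c_sp C (k + 1)) (d (k + 1) - c_R C k (d k)))\<^sup>2)"

definition M_comp :: "('d::real_vector, 'c, 'o) clean \<Rightarrow> (int \<Rightarrow> 'd) \<Rightarrow> real" where
  "M_comp C d = c_obs_norm C (c_obs C d) + c_CR C * Rep C d + c_CT C * c_Tax C d"

definition gauge_compatible :: "('d::real_vector, 'c, 'o) clean \<Rightarrow> bool" where
  "gauge_compatible C \<longleftrightarrow>
     (\<forall>d\<in>c_K C. \<forall>\<gamma>\<in>Gam C.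
        c_obs C (d + \<gamma>) = c_obs C d \<and> Rep C (d + \<gamma>) = Rep C d \<and> c_Tax C (d + \<gamma>) = c_Tax C d)"

definition kernel_free :: "('d::real_vector, 'c, 'o::real_vector) clean \<Rightarrow> bool" where
  "kernel_free C \<longleftrightarrow>
     (\<forall>d\<in>c_K C. c_obs C d = 0 \<and> Rep C d = 0 \<and> c_Tax C d = 0 \<longrightarrow> d \<in> Gam C)"

definition Q_cl :: "('d::real_vector, 'c, 'o) clean \<Rightarrow> (int \<Rightarrow> 'd) set set" where
  "Q_cl C = c_K C // {(x, y). x \<in> c_K C \<and> y \<in> c_K C \<and> x - y \<in> Gam C}"

text \<open>The function on cosets induced by a function that is constant on each coset.\<close>

definition descend :: "('a \<Rightarrow> real) \<Rightarrow> 'a set \<Rightarrow> real" where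
  "descend f q = the_elem (f ` q)"

definition S_cl :: "('d::real_vector, 'c, 'o) clean \<Rightarrow> (int \<Rightarrow> 'd) set set" where
  "S_cl C = {q \<in> Q_cl C. descend (dist_cl C) q = 1}"

definition mu_comp :: "('d::real_vector, 'c, 'o) clean \<Rightarrow> real" where
  "mu_comp C = (INF q\<in>S_cl C. descend (M_comp C) q)"


section \<open>The spaces \<open>L\<^sup>3\<^sup>/\<^sup>2(I; L\<^sup>3\<^sup>/\<^sup>2(B\<^sub>r))\<close>, \<open>I = (-1,0)\<close>\<close>

definition cyl :: "real \<Rightarrow> (real \<times> (real^3)) set" where
  "cyl r = {-1<..<0} \<times> ball 0 r"

text \<open>Elements of the Bochner space are represented by jointly measurable functions of
  \<open>(t, x)\<close>; by Tonelli, membership is joint integrability of the power.\<close>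

definition L32 :: "real \<Rightarrow> (real \<times> (real^3) \<Rightarrow> real) \<Rightarrow> bool" where
  "L32 r f \<longleftrightarrow> set_borel_measurable lborel (cyl r) f \<and>
     set_integrable lborel (cyl r) (\<lambda>p. \<bar>f p\<bar> powr (3/2))"

definition L32_norm_x :: "real \<Rightarrow> (real^3 \<Rightarrow> real) \<Rightarrow> real" where
  "L32_norm_x r g = (LINT x:ball 0 r|lborel. \<bar>g x\<bar> powr (3/2)) powr (2/3)"

definition L32_norm :: "real \<Rightarrow> (real \<times> (real^3) \<Rightarrow> real) \<Rightarrow> real" where
  "L32_norm r f = (LINT t:{-1<..<0}|lborel. L32_norm_x r (\<lambda>x. f (t, x)) powr (3/2)) powr (2/3)"

definition N32 :: "'a measure \<Rightarrow> ('a \<Rightarrow> real) \<Rightarrow> real" where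
  "N32 M f = (\<integral>p. \<bar>f p\<bar> powr (3/2) \<partial>M) powr (2/3)"

lemma cyl_sets [measurable]: "cyl r \<in> sets borel"
  unfolding cyl_def by (intro borel_open open_Times) auto

lemma L32_iff:
  "L32 r f \<longleftrightarrow> (\<lambda>p. indicator (cyl r) p * f p) \<in> borel_measurable lborel \<and>
     integrable lborel (\<lambda>p. \<bar>indicator (cyl r) p * f p\<bar> powr (3/2))"
proof -
  have "indicator (cyl r) p *\<^sub>R (\<bar>f p\<bar> powr (3/2)) = \<bar>indicator (cyl r) p * f p\<bar> powr (3/2)" for p
    by (simp add: indicator_def)
  then show ?thesis
    unfolding L32_def set_borel_measurable_def set_integrable_def by simp
qed

lemma L32_norm_eq:
  assumes "L32 r f"
  shows "L32_norm r f = N32 lborel (\<lambda>p. indicator (cyl r) p * f p)"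
proof -
  let ?h = "\<lambda>p. \<bar>indicator (cyl r) p * f p\<bar> powr (3/2)"
  have int: "integrable (lborel \<Otimes>\<^sub>M lborel) ?h"
    using assms unfolding L32_iff lborel_prod by blast
  have eq: "indicator {-1<..<0} t *\<^sub>R (L32_norm_x r (\<lambda>x. f (t, x)) powr (3/2))
      = (\<integral>x. ?h (t, x) \<partial>lborel)" for t
  proof -
    have *: "?h (t, x) = indicator {-1<..<0} t *\<^sub>R (indicator (ball 0 r) x *\<^sub>R \<bar>f (t, x)\<bar> powr (3/2))" for x
      by (auto simp: cyl_def indicator_def)
    have "0 \<le> (\<integral>x. indicator (ball 0 r) x *\<^sub>R \<bar>f (t, x)\<bar> powr (3/2) \<partial>lborel)"
      by (intro integral_nonneg_AE) auto
    then show ?thesis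
      unfolding * L32_norm_x_def set_lebesgue_integral_def by (simp add: powr_powr)
  qed
  show ?thesis
    unfolding L32_norm_def N32_def set_lebesgue_integral_def eq
    using lborel_pair.integral_fst'[OF int] by (simp add: lborel_prod)
qed

lemma powr32_convex:
  fixes a b u v :: real
  assumes "a > 0" "b > 0" "0 \<le> u" "0 \<le> v"
  shows "(u + v) powr (3/2) \<le>
    (a + b) powr (3/2) * (a / (a + b) * (u powr (3/2) / a powr (3/2))
      + b / (a + b) * (v powr (3/2) / b powr (3/2)))"
proof -
  have gen: "(s * x + t * y) powr (3/2) \<le> s * x powr (3/2) + t * y powr (3/2)"
    if st: "s > 0" "t > 0" "s + t = 1" and xy: "0 \<le> x" "0 \<le> y" for s t x y :: real
  proof -
    have small: "s' * z powr (3/2) \<ge> (s' * z) powr (3/2)" if "0 < s'" "s' \<le> 1" "0 \<le> z" for s' z :: real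
    proof -
      have "s' powr (3/2) \<le> s' powr 1"
        using that by (intro powr_mono') auto
      then show ?thesis using that by (simp add: powr_mult mult_right_mono)
    qed
    show ?thesis
    proof (cases "x = 0 \<or> y = 0")
      case True
      then show ?thesis using small[of s x] small[of t y] st xy by auto
    next
      case False
      have s: "s = 1 - t" using st by simp
      show ?thesis
        using convex_onD[OF powr_convex[of "3/2"], of t x y] False st xy
        unfolding s
        by simp
    qed
  qed
  have "u + v = (a + b) * (a / (a + b) * (u / a) + b / (a + b) * (v / b))"
  proof -
    have "(a + b) * (a / (a + b) * (u / a) + b / (a + b) * (v / b)) = (a + b) * ((u + v) / (a + b))"
      using assms by (simp add: add_divide_distrib)
    then show ?thesis using assms by simp
  qed
  then have "(u + v) powr (3/2)
      = (a + b) powr (3/2) * (a / (a + b) * (u / a) + b / (a + b) * (v / b)) powr (3/2)"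
    using assms by (metis powr_mult)
  also have "\<dots> \<le> (a + b) powr (3/2) *
      (a / (a + b) * (u / a) powr (3/2) + b / (a + b) * (v / b) powr (3/2))"
    using assms by (intro mult_left_mono gen) (auto simp flip: add_divide_distrib)
  finally show ?thesis using assms by (simp add: powr_divide)
qed

lemma N32_nonneg: "0 \<le> N32 M f"
  by (simp add: N32_def)

lemma N32_powr: "N32 M f powr (3/2) = (\<integral>p. \<bar>f p\<bar> powr (3/2) \<partial>M)"
  using integral_nonneg_AE[of "\<lambda>p. \<bar>f p\<bar> powr (3/2)" M] by (simp add: N32_def powr_powr)

lemma N32_eq_0:
  assumes "f \<in> borel_measurable M" "integrable M (\<lambda>p. \<bar>f p\<bar> powr (3/2))"
  shows "N32 M f = 0 \<longleftrightarrow> (AE p in M. f p = 0)"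
  using integral_nonneg_eq_0_iff_AE[OF assms(2)] by (simp add: N32_def)

lemma N32_add_integrable:
  fixes f g :: "'a \<Rightarrow> real"
  assumes [measurable]: "f \<in> borel_measurable M" "g \<in> borel_measurable M"
    and "integrable M (\<lambda>p. \<bar>f p\<bar> powr (3/2))" "integrable M (\<lambda>p. \<bar>g p\<bar> powr (3/2))"
  shows "integrable M (\<lambda>p. \<bar>f p + g p\<bar> powr (3/2))"
proof (rule Bochner_Integration.integrable_bound)
  let ?c = "2 powr (3/2) :: real"
  show "integrable M (\<lambda>p. ?c * (\<bar>f p\<bar> powr (3/2) + \<bar>g p\<bar> powr (3/2)))"
    using assms by auto
  have "\<bar>x + y\<bar> powr (3/2) \<le> ?c * (\<bar>x\<bar> powr (3/2) + \<bar>y\<bar> powr (3/2))" for x y :: real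
  proof -
    have "\<bar>x + y\<bar> powr (3/2) \<le> (\<bar>x\<bar> + \<bar>y\<bar>) powr (3/2)"
      by (intro powr_mono2) auto
    also have "\<dots> \<le> ?c * (1 / 2 * \<bar>x\<bar> powr (3/2) + 1 / 2 * \<bar>y\<bar> powr (3/2))"
      using powr32_convex[of 1 1 "\<bar>x\<bar>" "\<bar>y\<bar>"] by simp
    also have "\<dots> \<le> ?c * (\<bar>x\<bar> powr (3/2) + \<bar>y\<bar> powr (3/2))"
      by (intro mult_left_mono add_mono) auto
    finally show ?thesis .
  qed
  then show "AE p in M. norm (\<bar>f p + g p\<bar> powr (3/2))
      \<le> norm (?c * (\<bar>f p\<bar> powr (3/2) + \<bar>g p\<bar> powr (3/2)))"
    by (auto simp: abs_mult)
qed measurable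

lemma N32_cong_AE:
  assumes "f \<in> borel_measurable M" "g \<in> borel_measurable M" "AE p in M. f p = g p"
  shows "N32 M f = N32 M g"
proof -
  have "(\<integral>p. \<bar>f p\<bar> powr (3/2) \<partial>M) = (\<integral>p. \<bar>g p\<bar> powr (3/2) \<partial>M)"
    using assms by (intro integral_cong_AE) auto
  then show ?thesis by (simp add: N32_def)
qed

lemma N32_triangle:
  assumes f [measurable]: "f \<in> borel_measurable M" and g [measurable]: "g \<in> borel_measurable M"
    and fi: "integrable M (\<lambda>p. \<bar>f p\<bar> powr (3/2))" and gi: "integrable M (\<lambda>p. \<bar>g p\<bar> powr (3/2))"
  shows "N32 M (\<lambda>p. f p + g p) \<le> N32 M f + N32 M g"
proof -
  let ?a = "N32 M f" and ?b = "N32 M g"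
  consider "?a = 0" | "?b = 0" | "?a > 0" "?b > 0"
    using N32_nonneg[of M f] N32_nonneg[of M g] by linarith
  then show ?thesis
  proof cases
    case 1
    then have "AE p in M. f p = 0" using N32_eq_0[OF f fi] by simp
    then have "AE p in M. f p + g p = g p" by auto
    then have "N32 M (\<lambda>p. f p + g p) = N32 M g" by (intro N32_cong_AE) auto
    then show ?thesis using 1 by simp
  next
    case 2
    then have "AE p in M. g p = 0" using N32_eq_0[OF g gi] by simp
    then have "AE p in M. f p + g p = f p" by auto
    then have "N32 M (\<lambda>p. f p + g p) = N32 M f" by (intro N32_cong_AE) auto
    then show ?thesis using 2 by simp
  next
    case 3
    let ?K = "(?a + ?b) powr (3/2)"
    let ?r = "\<lambda>p. ?K * (?a / (?a + ?b) * (\<bar>f p\<bar> powr (3/2) / ?a powr (3/2))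
      + ?b / (?a + ?b) * (\<bar>g p\<bar> powr (3/2) / ?b powr (3/2)))"
    have pt: "\<bar>f p + g p\<bar> powr (3/2) \<le> ?r p" for p
    proof -
      have "\<bar>f p + g p\<bar> powr (3/2) \<le> (\<bar>f p\<bar> + \<bar>g p\<bar>) powr (3/2)"
        by (intro powr_mono2) auto
      also have "\<dots> \<le> ?r p"
        using powr32_convex[OF 3, of "\<bar>f p\<bar>" "\<bar>g p\<bar>"] by simp
      finally show ?thesis .
    qed
    have "(\<integral>p. \<bar>f p + g p\<bar> powr (3/2) \<partial>M) \<le> (\<integral>p. ?r p \<partial>M)"
    proof (rule integral_mono)
      show "integrable M (\<lambda>p. \<bar>f p + g p\<bar> powr (3/2))"
        by (rule N32_add_integrable[OF f g fi gi])
      show "integrable M ?r" using fi gi by simp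
    qed (rule pt)
    also have "\<dots> = ?K * (?a / (?a + ?b) * ((\<integral>p. \<bar>f p\<bar> powr (3/2) \<partial>M) / ?a powr (3/2))
      + ?b / (?a + ?b) * ((\<integral>p. \<bar>g p\<bar> powr (3/2) \<partial>M) / ?b powr (3/2)))"
      using fi gi by simp
    also have "\<dots> = ?K * (?a / (?a + ?b) + ?b / (?a + ?b))"
      using 3 by (simp flip: N32_powr)
    also have "?a / (?a + ?b) + ?b / (?a + ?b) = 1"
      using 3 by (simp flip: add_divide_distrib)
    finally have "(\<integral>p. \<bar>f p + g p\<bar> powr (3/2) \<partial>M) \<le> ?K" by simp
    then have "N32 M (\<lambda>p. f p + g p) \<le> ?K powr (2/3)"
      unfolding N32_def by (intro powr_mono2) (auto intro: integral_nonneg_AE)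
    then show ?thesis using 3 by (simp add: powr_powr)
  qed
qed

lemma N32_scale:
  "N32 M (\<lambda>p. c * f p) = \<bar>c\<bar> * N32 M f"
  by (simp add: N32_def abs_mult powr_mult powr_powr integral_nonneg_AE)

lemma L32_add: "L32 r f \<Longrightarrow> L32 r g \<Longrightarrow> L32 r (\<lambda>p. f p + g p)"
  using N32_add_integrable[of "\<lambda>p. indicator (cyl r) p * f p" lborel "\<lambda>p. indicator (cyl r) p * g p"]
  by (auto simp: L32_iff distrib_left)

lemma L32_scale: "L32 r f \<Longrightarrow> L32 r (\<lambda>p. c * f p)"
proof -
  assume f: "L32 r f"
  have "(\<lambda>p. c * (indicator (cyl r) p * f p)) \<in> borel_measurable lborel"
    "integrable lborel (\<lambda>p. \<bar>c * (indicator (cyl r) p * f p)\<bar> powr (3/2))"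
    using f by (auto simp: L32_iff abs_mult[of c] powr_mult)
  then show ?thesis by (simp add: L32_iff mult.left_commute)
qed

lemma L32_zero: "L32 r (\<lambda>p. 0)"
  by (simp add: L32_iff)

lemma L32_norm_triangle:
  "L32 r f \<Longrightarrow> L32 r g \<Longrightarrow> L32_norm r (\<lambda>p. f p + g p) \<le> L32_norm r f + L32_norm r g"
  using N32_triangle[of "\<lambda>p. indicator (cyl r) p * f p" lborel "\<lambda>p. indicator (cyl r) p * g p"]
  by (simp add: L32_norm_eq L32_add distrib_left) (simp add: L32_iff)

lemma L32_norm_scale: "L32 r f \<Longrightarrow> L32_norm r (\<lambda>p. c * f p) = \<bar>c\<bar> * L32_norm r f"
  using N32_scale[of lborel c "\<lambda>p. indicator (cyl r) p * f p"]
  by (simp add: L32_norm_eq L32_scale mult.left_commute)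

lemma L32_norm_eq_0:
  "L32 r f \<Longrightarrow> L32_norm r f = 0 \<longleftrightarrow> (AE p in lborel. p \<in> cyl r \<longrightarrow> f p = 0)"
  using N32_eq_0[of "\<lambda>p. indicator (cyl r) p * f p" lborel]
  by (simp add: L32_norm_eq) (simp add: L32_iff indicator_def)

lemma L32_norm_cong:
  assumes "L32 r f" "L32 r g" "AE p in lborel. p \<in> cyl r \<longrightarrow> f p = g p"
  shows "L32_norm r f = L32_norm r g"
proof -
  have "AE p in lborel. indicator (cyl r) p * f p = indicator (cyl r) p * g p"
    using assms(3) by eventually_elim (auto simp: indicator_def)
  then show ?thesis
    using assms(1,2) N32_cong_AE[of "\<lambda>p. indicator (cyl r) p * f p" lborel]
    by (simp add: L32_norm_eq) (simp add: L32_iff)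
qed

text \<open>The pressure space \<open>Y\<^sub>p\<^sub>r\<^sub>s\<close> (\<open>r = 1/2\<close>), as a type: functions modulo equality almost
  everywhere. \<open>abs_Yprs f\<close> is the class of \<open>f\<close>.\<close>

definition ae_rel :: "(real \<times> (real^3) \<Rightarrow> real) \<Rightarrow> (real \<times> (real^3) \<Rightarrow> real) \<Rightarrow> bool" where
  "ae_rel f g \<longleftrightarrow> L32 (1/2) f \<and> L32 (1/2) g \<and> (AE p in lborel. p \<in> cyl (1/2) \<longrightarrow> f p = g p)"

lemma ae_rel_part_equivp: "part_equivp ae_rel"
proof (rule part_equivpI)
  show "\<exists>x. ae_rel x x"
    by (rule exI[of _ "\<lambda>p. 0"]) (simp add: ae_rel_def L32_zero)
  show "symp ae_rel"
    by (auto intro!: sympI simp: ae_rel_def elim: eventually_mono)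
  show "transp ae_rel"
  proof (rule transpI)
    fix f g h assume a: "ae_rel f g" "ae_rel g h"
    then have "AE p in lborel. p \<in> cyl (1/2) \<longrightarrow> f p = g p"
      "AE p in lborel. p \<in> cyl (1/2) \<longrightarrow> g p = h p" by (auto simp: ae_rel_def)
    then have "AE p in lborel. p \<in> cyl (1/2) \<longrightarrow> f p = h p" by eventually_elim auto
    then show "ae_rel f h" using a by (simp add: ae_rel_def)
  qed
qed

quotient_type Yprs = "real \<times> (real^3) \<Rightarrow> real" / partial: ae_rel
  by (rule ae_rel_part_equivp)

lemma ae_rel_add:
  assumes "ae_rel f f'" "ae_rel g g'" shows "ae_rel (\<lambda>p. f p + g p) (\<lambda>p. f' p + g' p)"
proof -
  have "AE p in lborel. p \<in> cyl (1/2) \<longrightarrow> f p = f' p"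
    "AE p in lborel. p \<in> cyl (1/2) \<longrightarrow> g p = g' p" using assms by (auto simp: ae_rel_def)
  then have "AE p in lborel. p \<in> cyl (1/2) \<longrightarrow> f p + g p = f' p + g' p" by eventually_elim auto
  then show ?thesis using assms by (simp add: ae_rel_def L32_add)
qed

lemma ae_rel_scale: "ae_rel f f' \<Longrightarrow> ae_rel (\<lambda>p. c * f p) (\<lambda>p. c * f' p)"
  by (auto simp: ae_rel_def intro: L32_scale elim: eventually_mono)

instantiation Yprs :: real_normed_vector
begin

lift_definition zero_Yprs :: Yprs is "\<lambda>p. 0"
  by (simp add: ae_rel_def L32_zero)

lift_definition plus_Yprs :: "Yprs \<Rightarrow> Yprs \<Rightarrow> Yprs" is "\<lambda>f g p. f p + g p"
  by (rule ae_rel_add)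

lift_definition scaleR_Yprs :: "real \<Rightarrow> Yprs \<Rightarrow> Yprs" is "\<lambda>c f p. c * f p"
  by (rule ae_rel_scale)

lift_definition uminus_Yprs :: "Yprs \<Rightarrow> Yprs" is "\<lambda>f p. - 1 * f p"
  by (rule ae_rel_scale)

definition minus_Yprs :: "Yprs \<Rightarrow> Yprs \<Rightarrow> Yprs" where
  "minus_Yprs x y = x + - y"

lift_definition norm_Yprs :: "Yprs \<Rightarrow> real" is "L32_norm (1/2)"
  by (auto simp: ae_rel_def intro: L32_norm_cong)

definition dist_Yprs :: "Yprs \<Rightarrow> Yprs \<Rightarrow> real" where
  "dist_Yprs x y = norm (x - y)"

definition sgn_Yprs :: "Yprs \<Rightarrow> Yprs" where
  "sgn_Yprs x = inverse (norm x) *\<^sub>R x"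

definition uniformity_Yprs :: "(Yprs \<times> Yprs) filter" where
  "uniformity_Yprs = (INF e\<in>{0<..}. principal {(x, y). dist x y < e})"

definition open_Yprs :: "Yprs set \<Rightarrow> bool" where
  "open_Yprs U \<longleftrightarrow> (\<forall>x\<in>U. eventually (\<lambda>(x', y). x' = x \<longrightarrow> y \<in> U) uniformity)"

instance
proof
  fix x y z :: Yprs and a b :: real
  have L: "ae_rel f f" if "L32 (1/2) f" for f
    using that by (simp add: ae_rel_def)
  note sim = ae_rel_def L32_add L32_scale L32_zero
  show "x + y + z = x + (y + z)" by transfer (simp add: sim add.assoc)
  show "x + y = y + x" by transfer (simp add: sim add.commute)
  show "0 + x = x" by transfer (simp add: sim)
  show "- x + x = 0"
    by transfer (auto simp: ae_rel_def L32_zero dest: L32_add L32_scale[of _ _ "-1"])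
  show "x - y = x + - y" by (rule minus_Yprs_def)
  show "a *\<^sub>R (x + y) = a *\<^sub>R x + a *\<^sub>R y"
    by transfer (simp add: ae_rel_def L32_add L32_scale distrib_left)
  show "(a + b) *\<^sub>R x = a *\<^sub>R x + b *\<^sub>R x"
    by transfer (simp add: ae_rel_def L32_add L32_scale distrib_right)
  show "a *\<^sub>R b *\<^sub>R x = (a * b) *\<^sub>R x"
    by transfer (simp add: ae_rel_def L32_scale mult.assoc)
  show "1 *\<^sub>R x = x" by transfer (simp add: ae_rel_def)
  show "norm x = 0 \<longleftrightarrow> x = 0"
    by transfer (simp add: ae_rel_def L32_zero L32_norm_eq_0)
  show "norm (x + y) \<le> norm x + norm y"
    by transfer (simp add: ae_rel_def L32_norm_triangle)
  show "norm (a *\<^sub>R x) = \<bar>a\<bar> * norm x"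
    by transfer (simp add: ae_rel_def L32_norm_scale)
qed (rule dist_Yprs_def sgn_Yprs_def uniformity_Yprs_def open_Yprs_def)+

end


section \<open>Intrinsic packages\<close>

text \<open>Riesz transforms on \<open>\<real>\<^sup>3\<close> as principal values; the constant \<open>1 / pi\<^sup>2\<close> is
  \<open>Gamma ((n + 1) / 2) / pi powr ((n + 1) / 2)\<close> for \<open>n = 3\<close>. For functions in \<open>L\<^sup>p\<close> with
  \<open>1 < p < \<infinity>\<close> the limit exists almost everywhere and is again in \<open>L\<^sup>p\<close>
  (Calderon--Zygmund), so the class of \<open>riesz_pressure F\<close> in \<open>Yprs\<close> is meaningful.\<close>

definition riesz :: "3 \<Rightarrow> (real^3 \<Rightarrow> real) \<Rightarrow> real^3 \<Rightarrow> real" where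
  "riesz j f x = Lim (at_right 0)
     (\<lambda>\<epsilon>. 1 / pi\<^sup>2 * (LINT y:{y. \<epsilon> < norm y}|lborel. y $ j / norm y ^ 4 * f (x - y)))"

text \<open>\<open>R\<^sub>i R\<^sub>j F\<^sub>i\<^sub>j\<close> at time \<open>t\<close>, where \<open>F\<close> is extended by zero outside \<open>B\<^sub>1\<close>.\<close>

definition riesz_pressure :: "(real \<times> (real^3) \<Rightarrow> real^3^3) \<Rightarrow> real \<times> (real^3) \<Rightarrow> real" where
  "riesz_pressure F = (\<lambda>(t, x). \<Sum>i\<in>UNIV. \<Sum>j\<in>UNIV.
     riesz i (riesz j (\<lambda>y. indicator (ball 0 1) y * F (t, y) $ i $ j)) x)"

text \<open>Coordinates of a package are indexed by \<open>(k, j)\<close>, \<open>k \<in> \<Lambda>\<close>, \<open>1 \<le> j \<le> 7\<close>.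
  \<open>p_vel\<close> and \<open>p_cov\<close> give representatives of the clean velocity \<open>U\<close> and covariance \<open>R\<close> carried
  by a package, \<open>p_harm\<close> its harmonic pressure component; these are arbitrary functions of the
  package, not assumed linear.\<close>

type_synonym 'x package = "int \<times> nat \<Rightarrow> 'x"

record ('x, 'd, 'h) intrinsic =
  p_sp :: "int \<times> nat \<Rightarrow> 'x nspace"
  p_wt :: "nat \<Rightarrow> real"
  p_Gam :: "'x package set"
  p_Theta :: "'x package \<Rightarrow> int \<Rightarrow> 'd"
  p_M :: "'x package \<Rightarrow> real"
  p_Err :: "'x package \<Rightarrow> real"
  p_vel :: "'x package \<Rightarrow> real \<times> (real^3) \<Rightarrow> real^3"
  p_cov :: "'x package \<Rightarrow> real \<times> (real^3) \<Rightarrow> real^3^3"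
  p_harm :: "'x package \<Rightarrow> 'h"
  p_Pprs :: "Yprs \<Rightarrow> Yprs"
  p_Pi :: "'h \<Rightarrow> 'h"
  p_J :: "'h \<Rightarrow> Yprs"
  p_aproj :: real
  p_aharm :: real

definition packages ::
  "('d, 'c, 'o) clean \<Rightarrow> ('x::real_vector, 'd, 'h) intrinsic \<Rightarrow> 'x package set" where
  "packages C P = prod_space (Lam C \<times> {1..7}) (p_sp P)"

definition norm_loc ::
  "('d, 'c, 'o) clean \<Rightarrow> ('x::real_vector, 'd, 'h) intrinsic \<Rightarrow> 'x package \<Rightarrow> real" where
  "norm_loc C P D =
     sqrt (\<Sum>k\<in>Lam C. \<Sum>j=1..7. p_wt P j * (vnorm (p_sp P (k, j)) (D (k, j)))\<^sup>2)"

definition F_cl :: "('x, 'd, 'h) intrinsic \<Rightarrow> 'x package \<Rightarrow> real \<times> (real^3) \<Rightarrow> real^3^3" where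
  "F_cl P D p = (\<chi> i j. p_vel P D p $ i * p_vel P D p $ j + p_cov P D p $ i $ j)"

definition intrinsic_setting ::
  "('d::real_vector, 'c, 'o) clean \<Rightarrow>
   ('x::real_vector, 'd, 'h::real_normed_vector) intrinsic \<Rightarrow> bool" where
  "intrinsic_setting C P \<longleftrightarrow>
     (\<forall>k\<in>Lam C. \<forall>j\<in>{1..7}. normed_space (p_sp P (k, j))) \<and>
     (\<forall>j\<in>{1..7}. p_wt P j > 0) \<and>
     subspace (p_Gam P) \<and> p_Gam P \<subseteq> packages C P \<and>
     (\<forall>D\<in>packages C P. p_Theta P D \<in> c_K C) \<and>
     (\<forall>D\<in>packages C P. 0 \<le> p_M P D \<and> 0 \<le> p_Err P D) \<and>
     (\<forall>D\<in>packages C P. \<forall>i j. L32 1 (\<lambda>p. F_cl P D p $ i $ j)) \<and>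
     bounded_linear (p_Pprs P) \<and> p_Pprs P \<circ> p_Pprs P = p_Pprs P \<and>
     bounded_linear (p_Pi P) \<and> p_Pi P \<circ> p_Pi P = p_Pi P \<and> finite_dim (range (p_Pi P)) \<and>
     bounded_linear (p_J P) \<and>
     p_aproj P > 0 \<and> p_aharm P > 0"

definition T_proj ::
  "('x::real_vector, 'd, 'h) intrinsic \<Rightarrow> 'x package \<Rightarrow> 'x package \<Rightarrow> real" where
  "T_proj P D \<zeta> =
     (1 + onorm (p_Pprs P)) * norm (abs_Yprs (riesz_pressure (F_cl P (D - \<zeta>))))"

definition T_harm ::
  "('x::real_vector, 'd, 'h::real_normed_vector) intrinsic \<Rightarrow> 'x package \<Rightarrow> 'x package \<Rightarrow> real" where
  "T_harm P D \<zeta> = onorm (p_J P) * norm (p_harm P (D - \<zeta>) - p_Pi P (p_harm P (D - \<zeta>)))"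

definition dist_tail ::
  "('d, 'c, 'o) clean \<Rightarrow> ('x::real_vector, 'd, 'h::real_normed_vector) intrinsic \<Rightarrow>
   'x package \<Rightarrow> real" where
  "dist_tail C P D = (INF \<zeta>\<in>p_Gam P.
     norm_loc C P (D - \<zeta>) + p_aproj P * T_proj P D \<zeta> + p_aharm P * T_harm P D \<zeta>)"

end

theory Submission
  imports Defs
begin

text \<open>The companion detector and the quotient norm are both absolutely homogeneous on the quotient,
  so scaling to the unit sphere gives \<open>M_comp \<ge> mu_comp * dist_cl\<close> on \<open>c_K\<close>; the assumptions on the
  intrinsic package are then chained with this bound. The chain needs \<open>mu_comp \<ge> 0\<close>, hence a
  nonempty unit sphere (the infimum of an empty set of reals is a junk value). That holds because the
  finite-dimensional subspace \<open>Gam\<close> is closed, so that \<open>dist_cl\<close> is positive off \<open>Gam\<close>.\<close>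

section \<open>Norms on subspaces and distance to a finite span\<close>

lemma norm_on_subset: "norm_on V n \<Longrightarrow> W \<subseteq> V \<Longrightarrow> norm_on W n"
  by (simp add: norm_on_def subset_iff)

lemma norm_on_nonneg: "norm_on V n \<Longrightarrow> x \<in> V \<Longrightarrow> 0 \<le> n x"
  by (simp add: norm_on_def)

lemma norm_on_eq_0: "norm_on V n \<Longrightarrow> x \<in> V \<Longrightarrow> n x = 0 \<longleftrightarrow> x = 0"
  by (simp add: norm_on_def)

lemma norm_on_triangle: "norm_on V n \<Longrightarrow> x \<in> V \<Longrightarrow> y \<in> V \<Longrightarrow> n (x + y) \<le> n x + n y"
  by (simp add: norm_on_def)

lemma norm_on_scaleR: "norm_on V n \<Longrightarrow> x \<in> V \<Longrightarrow> n (c *\<^sub>R x) = \<bar>c\<bar> * n x"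
  by (simp add: norm_on_def)

lemma norm_on_diff:
  assumes n: "norm_on V n" "subspace V" "x \<in> V" "y \<in> V"
  shows "n (x - y) \<le> n x + n y"
proof -
  have "n (x + (-1) *\<^sub>R y) \<le> n x + n ((-1) *\<^sub>R y)"
    using norm_on_triangle[OF n(1,3) subspace_scale[OF n(2,4)]] .
  then show ?thesis using norm_on_scaleR[OF assms(1,4), of "-1"] by simp
qed

text \<open>Induction on the spanning set: if \<open>x - w\<^sub>m - t\<^sub>m b\<close> tends to zero with \<open>w\<^sub>m\<close> in the smaller span,
  then the positive distance of \<open>b\<close> from that span makes \<open>t\<^sub>m\<close> a Cauchy sequence of reals.\<close>

lemma norm_on_dist_span_pos:
  assumes n: "norm_on V n" and V: "subspace V" and "finite B" "B \<subseteq> V" "x \<in> V" "x \<notin> span B"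
  shows "\<exists>c>0. \<forall>w\<in>span B. c \<le> n (x - w)"
  using assms(3-)
proof (induction B arbitrary: x rule: finite_induct)
  case empty
  then have "n x > 0"
    using norm_on_nonneg[OF n] norm_on_eq_0[OF n] by (force simp: less_le)
  then show ?case by (intro exI[of _ "n x"]) simp
next
  case (insert b B)
  have bV: "b \<in> V" and BV: "B \<subseteq> V" using insert.prems by auto
  have sV: "span B \<subseteq> V" and sV': "span (insert b B) \<subseteq> V"
    using insert.prems V by (auto simp: span_minimal)
  show ?case
  proof (cases "b \<in> span B")
    case True
    then show ?thesis
      using insert.IH[OF BV] insert.prems by (simp add: span_redundant)
  next
    case False
    obtain c where c: "c > 0" and cb: "\<And>w. w \<in> span B \<Longrightarrow> c \<le> n (b - w)"
      using insert.IH[OF BV bV False] by blast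
    \<comment> \<open>For \<open>s \<noteq> 0\<close>, factoring out \<open>s\<close> leaves
      \<open>b\<close> minus a vector of \<open>span B\<close>, so the norm controls the coefficient
      of \<open>b\<close>.\<close>
    have cs: "c * \<bar>s\<bar> \<le> n (s *\<^sub>R b + u)" if u: "u \<in> span B" for s u
    proof (cases "s = 0")
      case True
      then show ?thesis using norm_on_nonneg[OF n, of u] u sV by auto
    next
      case False
      let ?w = "(- 1 / s) *\<^sub>R u"
      have w: "?w \<in> span B" using u by (rule span_scale)
      have "c * \<bar>s\<bar> \<le> \<bar>s\<bar> * n (b - ?w)"
        using mult_left_mono[OF cb[OF w], of "\<bar>s\<bar>"] by (simp add: mult.commute)
      also have "\<dots> = n (s *\<^sub>R (b - ?w))"
        using norm_on_scaleR[OF n subspace_diff[OF V bV], of ?w s] w sV by auto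
      also have "s *\<^sub>R (b - ?w) = s *\<^sub>R b + u" using False by (simp add: scaleR_right_distrib)
      finally show ?thesis .
    qed
    show ?thesis
    proof (rule ccontr)
      assume "\<not> ?thesis"
      then have "\<exists>w\<in>span (insert b B). n (x - w) < inverse (real (Suc m))" for m
        by (metis inverse_positive_iff_positive not_less of_nat_0_less_iff zero_less_Suc)
      then obtain w where w: "\<And>m. w m \<in> span (insert b B)"
        and nw: "\<And>m. n (x - w m) < inverse (real (Suc m))" by metis
      obtain t where t: "\<And>m. w m - t m *\<^sub>R b \<in> span B"
        using w unfolding span_breakdown_eq by metis
      have xw: "x - w m \<in> V" for m
        using w sV' insert.prems V by (auto intro: subspace_diff)
      \<comment> \<open>\<open>x\<close> cancels in the difference of two residuals, which leaves a
        multiple of \<open>b\<close> plus a vector of \<open>span B\<close>, as \<open>cs\<close>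
        requires.\<close>
      have Cb: "c * \<bar>t m - t k\<bar> \<le> inverse (real (Suc m)) + inverse (real (Suc k))" for m k
      proof -
        have "c * \<bar>t m - t k\<bar>
            \<le> n ((t m - t k) *\<^sub>R b + ((w m - t m *\<^sub>R b) - (w k - t k *\<^sub>R b)))"
          by (intro cs span_diff t)
        also have "(t m - t k) *\<^sub>R b + ((w m - t m *\<^sub>R b) - (w k - t k *\<^sub>R b))
            = (x - w k) - (x - w m)"
          by (simp add: algebra_simps)
        also have "n \<dots> \<le> n (x - w k) + n (x - w m)" by (intro norm_on_diff[OF n V] xw)
        finally show ?thesis using nw[of m] nw[of k] by linarith
      qed
      have "Cauchy t"
      proof (rule metric_CauchyI)
        fix e :: real assume "e > 0"
        then obtain N where N: "inverse (real (Suc N)) < c * e / 2"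
          using c reals_Archimedean[of "c * e / 2"] by auto
        have "dist (t m) (t k) < e" if "m \<ge> N" "k \<ge> N" for m k
        proof -
          have "inverse (real (Suc m)) \<le> inverse (real (Suc N))"
            "inverse (real (Suc k)) \<le> inverse (real (Suc N))"
            using that by (auto intro: le_imp_inverse_le)
          then have "c * \<bar>t m - t k\<bar> < c * e" using Cb[of m k] N by linarith
          then show ?thesis using c by (simp add: dist_real_def)
        qed
        then show "\<exists>N. \<forall>m\<ge>N. \<forall>k\<ge>N. dist (t m) (t k) < e" by blast
      qed
      then obtain T where T: "t \<longlonglongrightarrow> T" using Cauchy_convergent convergent_def by blast
      \<comment> \<open>The induction hypothesis holds for all vectors off \<open>span B\<close>; it
        is now applied to \<open>x\<close> shifted by the limit multiple of
        \<open>b\<close>.\<close>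
      have "x - T *\<^sub>R b \<notin> span B" using insert.prems by (auto simp: span_breakdown_eq)
      moreover have "x - T *\<^sub>R b \<in> V" using insert.prems V by (auto intro: subspace_diff subspace_scale)
      ultimately obtain c' where c': "c' > 0" "\<And>u. u \<in> span B \<Longrightarrow> c' \<le> n (x - T *\<^sub>R b - u)"
        using insert.IH[OF BV] by blast
      \<comment> \<open>Exchanging \<open>T\<close> for \<open>t m\<close> costs
        \<open>\<bar>t m - T\<bar> * n b\<close>, so the bound tends to zero and contradicts
        \<open>c' > 0\<close>.\<close>
      have le: "c' \<le> inverse (real (Suc m)) + \<bar>t m - T\<bar> * n b" for m
      proof -
        have "c' \<le> n (x - T *\<^sub>R b - (w m - t m *\<^sub>R b))" by (intro c' t)
        also have "x - T *\<^sub>R b - (w m - t m *\<^sub>R b) = (x - w m) + (t m - T) *\<^sub>R b"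
          by (simp add: algebra_simps)
        also have "n \<dots> \<le> n (x - w m) + n ((t m - T) *\<^sub>R b)"
          using bV V by (intro norm_on_triangle[OF n] xw subspace_scale)
        finally show ?thesis using nw[of m] norm_on_scaleR[OF n bV, of "t m - T"] by linarith
      qed
      have lim: "(\<lambda>m. inverse (real (Suc m)) + \<bar>t m - T\<bar> * n b) \<longlonglongrightarrow> 0 + \<bar>T - T\<bar> * n b"
        by (intro tendsto_intros T LIMSEQ_inverse_real_of_nat)
      have "c' \<le> 0 + \<bar>T - T\<bar> * n b" using le by (intro LIMSEQ_le_const[OF lim]) auto
      then show False using c' by simp
    qed
  qed
qed

text \<open>A maximal independent subset of \<open>W\<close> spans \<open>W\<close>, and it is
  finite because an independent set inside \<open>span A\<close> has at most as many elements as
  \<open>A\<close>.\<close>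

lemma subspace_of_finite_span:
  assumes "subspace W" "W \<subseteq> span A" "finite A"
  obtains B where "finite B" "B \<subseteq> W" "W = span B"
proof -
  obtain B where B: "B \<subseteq> W" "independent B" "W \<subseteq> span B"
    using maximal_independent_subset[of W] by blast
  have "finite B" using independent_span_bound[OF assms(3) B(2)] B(1) assms(2) by blast
  moreover have "span B \<subseteq> W" using B(1) assms(1) by (rule span_minimal)
  ultimately show thesis using that B by blast
qed

section \<open>The quotient norm and homogeneity of the detector\<close>

context
  fixes C :: "('d::real_vector, 'c::real_normed_vector, 'o::real_vector) clean"
  assumes setting: "clean_setting C"
begin

lemma subspace_K: "subspace (c_K C)"
  using setting by (simp add: clean_setting_def)

lemma norm_on_K: "norm_on (c_K C) (c_norm C)"
  using setting norm_on_subset by (auto simp: clean_setting_def)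

lemma subspace_Gam: "subspace (Gam C)"
  using setting linear_subspace_image[of "c_G C" UNIV]
  by (auto simp: Gam_def clean_setting_def intro: subspace_inter)

lemma Gam_subset_K: "Gam C \<subseteq> c_K C"
  by (auto simp: Gam_def)

text \<open>The range of \<open>c_G\<close> is spanned by the image of a finite spanning set of its
  domain, and \<open>Gam\<close> is a subspace of that range.\<close>

lemma Gam_finite_span: obtains B where "finite B" "B \<subseteq> Gam C" "Gam C = span B"
proof -
  obtain A where A: "finite A" "(UNIV :: 'c set) = span A"
    using setting by (auto simp: clean_setting_def finite_dim_def)
  have "linear (c_G C)" using setting by (simp add: clean_setting_def)
  then have "range (c_G C) = span (c_G C ` A)" using A by (simp add: linear_span_image)
  then have "Gam C \<subseteq> span (c_G C ` A)" by (auto simp: Gam_def)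
  then show thesis using subspace_of_finite_span[OF subspace_Gam] A that by blast
qed

lemma diff_Gam_in_K: "d \<in> c_K C \<Longrightarrow> \<gamma> \<in> Gam C \<Longrightarrow> d - \<gamma> \<in> c_K C"
  using Gam_subset_K subspace_K by (auto intro: subspace_diff)

lemma bdd_below_dist_cl: "d \<in> c_K C \<Longrightarrow> bdd_below ((\<lambda>\<gamma>. c_norm C (d - \<gamma>)) ` Gam C)"
  by (intro bdd_belowI2[of _ 0] norm_on_nonneg[OF norm_on_K] diff_Gam_in_K)

lemma Gam_nonempty: "Gam C \<noteq> {}"
  using subspace_0[OF subspace_Gam] by blast

lemma dist_cl_nonneg: "d \<in> c_K C \<Longrightarrow> 0 \<le> dist_cl C d"
  unfolding dist_cl_def
  by (intro cINF_greatest Gam_nonempty norm_on_nonneg[OF norm_on_K] diff_Gam_in_K)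

lemma dist_cl_pos:
  assumes "d \<in> c_K C" "d \<notin> Gam C"
  shows "0 < dist_cl C d"
proof -
  obtain B where B: "finite B" "B \<subseteq> Gam C" "Gam C = span B" by (rule Gam_finite_span)
  then obtain c where "c > 0" "\<forall>w\<in>Gam C. c \<le> c_norm C (d - w)"
    using norm_on_dist_span_pos[OF norm_on_K subspace_K, of B d] assms Gam_subset_K by auto
  then have "c \<le> dist_cl C d" unfolding dist_cl_def using Gam_nonempty by (intro cINF_greatest) auto
  with \<open>c > 0\<close> show ?thesis by linarith
qed

text \<open>Translation by \<gamma> permutes \<open>Gam\<close>, so both infima run over the same
  set of values.\<close>

lemma dist_cl_add_Gam:
  assumes "\<gamma> \<in> Gam C"
  shows "dist_cl C (d + \<gamma>) = dist_cl C d"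
proof -
  have "(\<lambda>\<beta>. c_norm C (d + \<gamma> - \<beta>)) ` Gam C = (\<lambda>\<beta>. c_norm C (d - \<beta>)) ` (\<lambda>\<beta>. \<beta> - \<gamma>) ` Gam C"
    by (auto simp: image_image algebra_simps)
  also have "(\<lambda>\<beta>. \<beta> - \<gamma>) ` Gam C = Gam C"
  proof
    show "(\<lambda>\<beta>. \<beta> - \<gamma>) ` Gam C \<subseteq> Gam C" using assms subspace_Gam by (auto intro: subspace_diff)
    show "Gam C \<subseteq> (\<lambda>\<beta>. \<beta> - \<gamma>) ` Gam C"
      using assms subspace_Gam by (auto intro!: image_eqI[where x = "_ + \<gamma>"] subspace_add)
  qed
  finally show ?thesis unfolding dist_cl_def by (rule arg_cong[where f = Inf])
qed

text \<open>Each competitor \<gamma> for \<open>d\<close> yields the competitor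
  \<open>t *\<^sub>R \<gamma>\<close> for \<open>t *\<^sub>R d\<close>.\<close>

lemma dist_cl_scaleR_le:
  assumes "d \<in> c_K C" "t > 0"
  shows "dist_cl C (t *\<^sub>R d) \<le> t * dist_cl C d"
proof -
  have "dist_cl C (t *\<^sub>R d) / t \<le> dist_cl C d"
    unfolding dist_cl_def[of C d]
  proof (rule cINF_greatest[OF Gam_nonempty])
    fix \<gamma> assume \<gamma>: "\<gamma> \<in> Gam C"
    have "dist_cl C (t *\<^sub>R d) \<le> c_norm C (t *\<^sub>R d - t *\<^sub>R \<gamma>)"
      unfolding dist_cl_def using \<gamma> assms subspace_Gam subspace_K
      by (intro cINF_lower bdd_below_dist_cl) (auto intro: subspace_scale)
    also have "\<dots> = t * c_norm C (d - \<gamma>)"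
      using norm_on_scaleR[OF norm_on_K diff_Gam_in_K[OF assms(1) \<gamma>], of t] assms
      by (simp add: scaleR_diff_right)
    finally show "dist_cl C (t *\<^sub>R d) / t \<le> c_norm C (d - \<gamma>)"
      using assms by (simp add: field_simps)
  qed
  then show ?thesis using assms by (simp add: field_simps)
qed

lemma dist_cl_scaleR:
  assumes "d \<in> c_K C" "t > 0"
  shows "dist_cl C (t *\<^sub>R d) = t * dist_cl C d"
proof (rule antisym[OF dist_cl_scaleR_le[OF assms]])
  \<comment> \<open>The reverse inequality is the same bound with factor \<open>1 / t\<close>,
    applied to the scaled vector.\<close>
  have "dist_cl C ((1 / t) *\<^sub>R (t *\<^sub>R d)) \<le> (1 / t) * dist_cl C (t *\<^sub>R d)"
    using assms subspace_K by (intro dist_cl_scaleR_le) (auto intro: subspace_scale)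
  then show "t * dist_cl C d \<le> dist_cl C (t *\<^sub>R d)" using assms by (simp add: field_simps)
qed

lemma Rep_scaleR:
  assumes "d \<in> c_K C"
  shows "Rep C (t *\<^sub>R d) = \<bar>t\<bar> * Rep C d"
proof -
  have "vnorm (c_sp C (k + 1)) ((t *\<^sub>R d) (k + 1) - c_R C k ((t *\<^sub>R d) k))
      = \<bar>t\<bar> * vnorm (c_sp C (k + 1)) (d (k + 1) - c_R C k (d k))" if k: "k \<in> Lam_adj C" for k
  proof -
    have kL: "k \<in> Lam C" "k + 1 \<in> Lam C" using k by (auto simp: Lam_adj_def)
    have dk: "d k \<in> vecs (c_sp C k)" "d (k + 1) \<in> vecs (c_sp C (k + 1))"
      using assms setting kL by (auto simp: clean_setting_def D_cl_def prod_space_def)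
    have R: "linear_on (vecs (c_sp C k)) (c_R C k)"
      "c_R C k ` vecs (c_sp C k) \<subseteq> vecs (c_sp C (k + 1))"
      using k setting by (auto simp: clean_setting_def)
    have S: "subspace (vecs (c_sp C (k + 1)))" "norm_on (vecs (c_sp C (k + 1))) (vnorm (c_sp C (k + 1)))"
      using kL setting by (auto simp: clean_setting_def normed_space_def)
    have "d (k + 1) - c_R C k (d k) \<in> vecs (c_sp C (k + 1))"
      using R dk S by (auto intro: subspace_diff)
    from norm_on_scaleR[OF S(2) this, of t] show ?thesis
      using R(1) dk by (simp add: scaleR_fun_def linear_on_def scaleR_diff_right)
  qed
  then have "Rep C (t *\<^sub>R d) = sqrt (\<Sum>k\<in>Lam_adj C.
      t\<^sup>2 * (vnorm (c_sp C (k + 1)) (d (k + 1) - c_R C k (d k)))\<^sup>2)"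
    unfolding Rep_def by (auto simp: power_mult_distrib intro!: sum.cong)
  then show ?thesis
    by (simp add: Rep_def real_sqrt_mult flip: sum_distrib_left)
qed

lemma c_obs_in_obs_space: "d \<in> c_K C \<Longrightarrow> c_obs C d \<in> obs_space C"
  using setting by (auto simp: clean_setting_def)

lemma norm_on_obs_space: "norm_on (obs_space C) (c_obs_norm C)"
  using setting by (simp add: clean_setting_def)

lemma M_comp_scaleR:
  assumes "d \<in> c_K C"
  shows "M_comp C (t *\<^sub>R d) = \<bar>t\<bar> * M_comp C d"
proof -
  have "c_obs C (t *\<^sub>R d) = t *\<^sub>R c_obs C d" "c_Tax C (t *\<^sub>R d) = \<bar>t\<bar> * c_Tax C d"
    using setting assms by (auto simp: clean_setting_def linear_on_def)
  then show ?thesis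
    using norm_on_scaleR[OF norm_on_obs_space c_obs_in_obs_space[OF assms], of t] Rep_scaleR[OF assms]
    by (simp add: M_comp_def algebra_simps)
qed

lemma M_comp_nonneg:
  assumes "d \<in> c_K C"
  shows "0 \<le> M_comp C d"
proof -
  have "0 \<le> c_Tax C d" "0 < c_CR C" "0 < c_CT C" using setting assms by (auto simp: clean_setting_def)
  moreover have "0 \<le> Rep C d" by (simp add: Rep_def sum_nonneg)
  ultimately show ?thesis
    using norm_on_nonneg[OF norm_on_obs_space c_obs_in_obs_space[OF assms]] by (simp add: M_comp_def)
qed

text \<open>Written through \<open>d - y\<close> to match the equivalence relation in
  \<open>Q_cl\<close>; for \<open>d\<close> in \<open>c_K\<close> this is the translate of
  \<open>Gam\<close> by \<open>d\<close>.\<close>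

definition coset :: "(int \<Rightarrow> 'd) \<Rightarrow> (int \<Rightarrow> 'd) set" where
  "coset d = {y \<in> c_K C. d - y \<in> Gam C}"

lemma Q_cl_eq: "Q_cl C = coset ` c_K C"
  by (auto simp: Q_cl_def quotient_def coset_def)

text \<open>Invariance under \<open>Gam\<close> makes the image of the coset a singleton, the case
  in which \<open>the_elem\<close> has a determined value.\<close>

lemma descend_coset:
  assumes f: "\<And>d \<gamma>. d \<in> c_K C \<Longrightarrow> \<gamma> \<in> Gam C \<Longrightarrow> f (d + \<gamma>) = f d" and d: "d \<in> c_K C"
  shows "descend f (coset d) = f d"
proof -
  have "f y = f d" if "y \<in> coset d" for y
    using f[of y "d - y"] that by (simp add: coset_def)
  moreover have "d \<in> coset d"
    using d subspace_0[OF subspace_Gam] by (simp add: coset_def)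
  ultimately have "f ` coset d = {f d}" by blast
  then show ?thesis by (simp add: descend_def)
qed

lemma coset_in_S_cl:
  assumes "d \<in> c_K C" "dist_cl C d > 0"
  shows "coset ((1 / dist_cl C d) *\<^sub>R d) \<in> S_cl C"
proof -
  let ?u = "(1 / dist_cl C d) *\<^sub>R d"
  have u: "?u \<in> c_K C" using assms(1) subspace_K by (intro subspace_scale)
  have "descend (dist_cl C) (coset ?u) = 1"
    using assms by (simp add: descend_coset[where f = "dist_cl C", OF dist_cl_add_Gam u] dist_cl_scaleR)
  then show ?thesis using u by (auto simp: S_cl_def Q_cl_eq)
qed

text \<open>A quotient other than the zero space contains the class of some \<open>d\<close> outside
  \<open>Gam\<close>; its distance is positive, so it can be normalised.\<close>

lemma S_cl_nonempty:
  assumes "Q_cl C \<noteq> {Gam C}"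
  shows "S_cl C \<noteq> {}"
proof -
  have "c_K C \<noteq> Gam C"
  proof
    assume K: "c_K C = Gam C"
    have "coset d = Gam C" if "d \<in> Gam C" for d
      using that subspace_diff[OF subspace_Gam] by (auto simp: coset_def K)
    then have "Q_cl C = {Gam C}" using Gam_nonempty by (auto simp: Q_cl_eq K)
    with assms show False ..
  qed
  then obtain d where "d \<in> c_K C" "d \<notin> Gam C" using Gam_subset_K by blast
  then show ?thesis using coset_in_S_cl dist_cl_pos by blast
qed

section \<open>Coercivity of the detector modulo gauge\<close>

context
  assumes gauge: "gauge_compatible C"
begin

lemma descend_M_comp: "d \<in> c_K C \<Longrightarrow> descend (M_comp C) (coset d) = M_comp C d"
  using gauge by (simp add: descend_coset[where f = "M_comp C"] gauge_compatible_def M_comp_def)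

lemma descend_M_comp_nonneg: "q \<in> S_cl C \<Longrightarrow> 0 \<le> descend (M_comp C) q"
  by (auto simp: S_cl_def Q_cl_eq descend_M_comp M_comp_nonneg)

lemma mu_comp_nonneg: "Q_cl C \<noteq> {Gam C} \<Longrightarrow> 0 \<le> mu_comp C"
  unfolding mu_comp_def by (intro cINF_greatest S_cl_nonempty descend_M_comp_nonneg)

text \<open>Both sides are homogeneous of degree one, so for positive distance it suffices to
  compare on the normalised class; at distance zero the left side vanishes.\<close>

lemma M_comp_ge_dist_cl:
  assumes d: "d \<in> c_K C"
  shows "mu_comp C * dist_cl C d \<le> M_comp C d"
proof (cases "dist_cl C d = 0")
  case True
  then show ?thesis using M_comp_nonneg[OF d] by simp
next
  case False
  then have pos: "dist_cl C d > 0" using dist_cl_nonneg[OF d] by simp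
  let ?u = "(1 / dist_cl C d) *\<^sub>R d"
  have "mu_comp C \<le> descend (M_comp C) (coset ?u)"
    unfolding mu_comp_def
    by (intro cINF_lower bdd_belowI2[of _ 0] descend_M_comp_nonneg coset_in_S_cl d pos)
  also have "\<dots> = M_comp C d / dist_cl C d"
    using d pos subspace_K by (simp add: descend_M_comp subspace_scale M_comp_scaleR)
  finally show ?thesis using pos by (simp add: field_simps)
qed

end

end

section \<open>Transfer to intrinsic packages\<close>

theorem theorem9p92:
  fixes C :: "('d::real_vector, 'c::real_normed_vector, 'o::real_vector) clean"
    and P :: "('x::real_vector, 'd, 'h::real_normed_vector) intrinsic"
    and \<epsilon>G \<delta>G \<eta> \<Delta> :: real
  assumes "clean_setting C" and "intrinsic_setting C P"
    and "Q_cl C \<noteq> {Gam C}"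
    and "gauge_compatible C" and "kernel_free C"
    and "0 \<le> \<epsilon>G" and "\<epsilon>G < 1" and "0 \<le> \<delta>G" and "0 \<le> \<eta>" and "0 \<le> \<Delta>"
    and "\<And>D. D \<in> packages C P \<Longrightarrow>
      dist_cl C (p_Theta P D) \<ge> (1 - \<epsilon>G) * dist_tail C P D - \<delta>G"
    and "\<And>D. D \<in> packages C P \<Longrightarrow>
      p_M P D + p_Err P D \<ge> M_comp C (p_Theta P D)"
    and "\<And>D. D \<in> packages C P \<Longrightarrow>
      p_Err P D \<le> \<eta> * dist_tail C P D + \<Delta>"
  shows "\<forall>D\<in>packages C P.
    p_M P D \<ge> (mu_comp C * (1 - \<epsilon>G) - \<eta>) * dist_tail C P D - mu_comp C * \<delta>G - \<Delta>"
proof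
  fix D assume D: "D \<in> packages C P"
  have \<Theta>: "p_Theta P D \<in> c_K C" using assms(2) D by (auto simp: intrinsic_setting_def)
  \<comment> \<open>Multiplying the distance comparison by \<open>mu_comp C\<close> keeps its
    direction because this factor is nonnegative.\<close>
  have "mu_comp C * ((1 - \<epsilon>G) * dist_tail C P D - \<delta>G) \<le> mu_comp C * dist_cl C (p_Theta P D)"
    using assms(11)[OF D] mu_comp_nonneg[OF assms(1,4,3)] by (rule mult_left_mono)
  also have "\<dots> \<le> M_comp C (p_Theta P D)" by (rule M_comp_ge_dist_cl[OF assms(1,4) \<Theta>])
  also have "\<dots> \<le> p_M P D + (\<eta> * dist_tail C P D + \<Delta>)" using assms(12,13)[OF D] by linarith
  finally show "p_M P D
      \<ge> (mu_comp C * (1 - \<epsilon>G) - \<eta>) * dist_tail C P D - mu_comp C * \<delta>G - \<Delta>"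
    by (simp add: algebra_simps)
qed

end
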